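(* Let $N\ge 16$ be an integer, and write $N=3k+i$ with $k\in\mathbb{N}$ and $i\in\{0,1,2\}$. Let $P^N_*$ denote the maximal number of finite paths $|FP(E)|$ over all connected acyclic directed graphs $E$ with exactly $N$ edges. Then $$P^N_*=\begin{cases}\frac14\left(121\cdot 3^{k-2}-2k+7\right) & \text{if } i=0,\\[2pt] \frac14\left(529\cdot 3^{k-3}-2k+25\right) & \text{if } i=1,\\[2pt] \frac14\left(253\cdot 3^{k-2}-2k+15\right) & \text{if } i=2.\end{cases}$$
   Context: A directed graph $E=(E^0,E^1,s_E,t_E)$ consists of a set of vertices $E^0$, a set of edges $E^1$, and source and target maps $s_E,t_E\colon E^1\to E^0$ (multiple edges are allowed). A finite path of length $n\ge1$ is a tuple $(e_1,\dots,e_n)$ of edges with $t_E(e_i)=s_E(e_{i+1})$ for $1\le i<n$; vertices are paths of length $0$. $FP(E)$ is the set of all finite paths in $E$ (including those of length $0$). $E$ is acyclic if it has no path of positive length whose beginning and end coincide. $E$ is connected if any two vertices are joined by a finite undirected path. *)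

theory Defs
  imports Complex_Main "Graph_Theory.Graph_Theory"
begin

definition acyclic_digraph :: "('v, 'e) pre_digraph \<Rightarrow> bool" where
  "acyclic_digraph E \<longleftrightarrow> \<not> (\<exists>u p. p \<noteq> [] \<and> pre_digraph.awalk E u p u)"

text \<open>
  The left summand holds the paths of length 0, identified with the vertices; the right
  summand holds the paths of positive length, which are tuples of edges.
\<close>

definition FP :: "('v, 'e) pre_digraph \<Rightarrow> ('v + 'e list) set" where
  "FP E = verts E <+> {p. p \<noteq> [] \<and> (\<exists>u v. pre_digraph.awalk E u p v)}"

text \<open>
  For \<open>N > 0\<close>, \<open>card (arcs E) = N\<close> forces the edge set to be finite, connectedness then
  forces the vertex set to be finite, and acyclicity makes \<^term>\<open>FP E\<close> finite. So
  \<^term>\<open>card (FP E)\<close> is the true number of finite paths.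
\<close>

definition conn_acyclic_digraph :: "nat \<Rightarrow> ('v, 'e) pre_digraph \<Rightarrow> bool" where
  "conn_acyclic_digraph N E \<longleftrightarrow>
     wf_digraph E \<and> connected E \<and> acyclic_digraph E \<and> card (arcs E) = N"

text \<open>
  For \<open>N > 0\<close> every graph in question is finite, hence isomorphic to one whose vertices and
  edges are natural numbers.
\<close>

definition P_star :: "nat \<Rightarrow> nat" where
  "P_star N = Max {card (FP E) | E :: (nat, nat) pre_digraph. conn_acyclic_digraph N E}"

end

theory Submission
  imports Defs
begin

text \<open>
  The number of walks ending at a vertex \<open>v\<close> is one more than the sum, over the arcs into \<open>v\<close>, of
  the number of walks ending at their tails. This sum grows if every arc into \<open>v\<close> is made to start
  at the predecessor with the most walks, so the best graph is a line of bundles of parallel arcs,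
  given by a composition of \<open>N\<close>; surplus sources lose at least as many walks as they add vertices.
  Splitting a bundle of at least four arcs gains paths, so only bundles of one, two or three arcs
  matter. An induction on \<open>N\<close> with linear bounds on the number of all paths and of paths to the end
  then shows that the best lines are \<open>1, 2, 3, \<dots>, 3, 2, 1\<close> up to an additional \<open>2\<close> near the ends.
\<close>

section \<open>Compositions of \<open>N\<close>\<close>

text \<open>
  A list gives the sizes of the bundles of parallel arcs along a line, its head being the last
  bundle. The paths counted by \<open>end_paths\<close> end at the last vertex.
\<close>

primrec end_paths :: "nat list \<Rightarrow> nat" where
  "end_paths [] = 1"
| "end_paths (x # xs) = 1 + x * end_paths xs"

primrec all_paths :: "nat list \<Rightarrow> nat" where
  "all_paths [] = 1"
| "all_paths (x # xs) = end_paths (x # xs) + all_paths xs"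

text \<open>Since \<open>2 * (x - 2) \<ge> x\<close> for \<open>x \<ge> 4\<close>, a bundle of
  \<open>x\<close> arcs can give way to one of \<open>x - 2\<close> arcs followed by one of 2
  without lowering either count. Induction then treats \<open>x - 2\<close>.\<close>

lemma split_large_entry:
  "x \<ge> 1 \<Longrightarrow> set ys \<subseteq> {1, 2, 3} \<Longrightarrow>
    \<exists>zs. set zs \<subseteq> {1, 2, 3} \<and> sum_list zs = x + sum_list ys
      \<and> end_paths (x # ys) \<le> end_paths zs \<and> all_paths (x # ys) \<le> all_paths zs"
proof (induction x rule: less_induct)
  case (less x)
  show ?case
  proof (cases "x \<le> 3")
    case True
    then have "x = 1 \<or> x = 2 \<or> x = 3" using less.prems by linarith
    then show ?thesis using less.prems by (intro exI[of _ "x # ys"]) auto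
  next
    case False
    then obtain y where y: "x = y + 4" using le_Suc_ex[of 4 x] by auto
    obtain zs where zs: "set zs \<subseteq> {1, 2, 3}" "sum_list zs = (y + 2) + sum_list ys"
      "end_paths ((y + 2) # ys) \<le> end_paths zs" "all_paths ((y + 2) # ys) \<le> all_paths zs"
      using less.IH[of "y + 2"] less.prems y by auto
    have "end_paths (x # ys) \<le> end_paths (2 # zs)" "all_paths (x # ys) \<le> all_paths (2 # zs)"
      using zs(3,4) by (auto simp: y algebra_simps)
    then show ?thesis using zs(1,2) y by (intro exI[of _ "2 # zs"]) auto
  qed
qed

text \<open>Both counts are monotone in the counts of the part of the line already treated, so the
  bundles can be split one by one from the start of the line.\<close>

lemma small_entries_suffice:
  assumes "\<forall>x\<in>set xs. x \<ge> 1"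
  shows "\<exists>ys. set ys \<subseteq> {1, 2, 3} \<and> sum_list ys = sum_list xs
    \<and> end_paths xs \<le> end_paths ys \<and> all_paths xs \<le> all_paths ys"
  using assms
proof (induction xs)
  case Nil
  then show ?case by (intro exI[of _ "[]"]) auto
next
  case (Cons x xs)
  then obtain ys where ys: "set ys \<subseteq> {1, 2, 3}" "sum_list ys = sum_list xs"
    "end_paths xs \<le> end_paths ys" "all_paths xs \<le> all_paths ys" by auto
  obtain zs where zs: "set zs \<subseteq> {1, 2, 3}" "sum_list zs = x + sum_list ys"
    "end_paths (x # ys) \<le> end_paths zs" "all_paths (x # ys) \<le> all_paths zs"
    using split_large_entry[of x ys] Cons.prems ys(1) by auto
  have "end_paths (x # xs) \<le> end_paths (x # ys)" "all_paths (x # xs) \<le> all_paths (x # ys)"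
    using ys(3,4) by (auto intro!: add_mono mult_left_mono)
  then show ?case using zs ys(2) by (intro exI[of _ zs]) (auto simp del: end_paths.simps all_paths.simps)
qed

section \<open>Linear bounds on the path counts of compositions\<close>

text \<open>
  If \<open>T\<close> and \<open>L\<close> count all paths and the paths to the end, prepending \<open>x\<close> turns \<open>T + w * L\<close> into
  \<open>T + x * (1 + w) * L\<close> up to a constant. The weights \<open>w = 0, 1, 4, 8\<close> suffice for an
  induction: the weights that arise from \<open>x = 1, 2, 3\<close> are bounded by interpolating between these
  and, beyond 8, by the separate bound on \<open>L\<close>.
\<close>

definition bounded_at :: "int \<Rightarrow> real \<Rightarrow> real \<Rightarrow> real \<Rightarrow> real \<Rightarrow> real \<Rightarrow> bool" where
  "bounded_at n a b c d s \<longleftrightarrow>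
    (\<forall>xs. set xs \<subseteq> {1, 2, 3} \<and> int (sum_list xs) = n \<longrightarrow>
      real (all_paths xs) \<le> a \<and> real (all_paths xs) + real (end_paths xs) \<le> b
      \<and> real (all_paths xs) + 4 * real (end_paths xs) \<le> c
      \<and> real (all_paths xs) + 8 * real (end_paths xs) \<le> d \<and> real (end_paths xs) \<le> s)"

text \<open>The conditions in each of \<open>a\<close> to \<open>s\<close> treat a last bundle of 1,
  2 and 3 arcs in turn. The weights 0, 1, 4, 8 become 1, 2, 3; 2, 4, 6; 5, 10, 15; 9, 18, 27.
  Interpolation, with denominators cleared, uses for instance \<open>2 = (2 * 1 + 4) / 3\<close>;
  beyond 8 the excess is charged to the bound on \<open>end_paths\<close>, as in
  \<open>27 = 8 + 19\<close>.\<close>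

lemma bounded_at_step:
  assumes b3: "bounded_at n3 a3 b3 c3 d3 s3"
    and b2: "bounded_at n2 a2 b2 c2 d2 s2"
    and b1: "bounded_at n1 a1 b1 c1 d1 s1"
    and n: "n3 = n - 3" "n2 = n - 2" "n1 = n - 1"
    and a: "1 + b1 \<le> a" "3 + 2 * b2 + c2 \<le> 3 * a" "3 + b3 + 2 * c3 \<le> 3 * a"
    and b: "6 + 2 * b1 + c1 \<le> 3 * b" "2 + c2 \<le> b" "4 + c3 + d3 \<le> 2 * b"
    and c: "20 + 3 * c1 + d1 \<le> 4 * c" "5 + d2 + 2 * s2 \<le> c" "5 + d3 + 7 * s3 \<le> c"
    and d: "9 + d1 + s1 \<le> d" "9 + d2 + 10 * s2 \<le> d" "9 + d3 + 19 * s3 \<le> d"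
    and s: "1 + s1 \<le> s" "1 + 2 * s2 \<le> s" "1 + 3 * s3 \<le> s"
    and nil: "n = 0 \<Longrightarrow> 1 \<le> a \<and> 2 \<le> b \<and> 5 \<le> c \<and> 9 \<le> d \<and> 1 \<le> s"
  shows "bounded_at n a b c d s"
  unfolding bounded_at_def
proof (intro allI impI)
  fix xs :: "nat list"
  assume xs: "set xs \<subseteq> {1, 2, 3} \<and> int (sum_list xs) = n"
  show "real (all_paths xs) \<le> a \<and> real (all_paths xs) + real (end_paths xs) \<le> b
      \<and> real (all_paths xs) + 4 * real (end_paths xs) \<le> c
      \<and> real (all_paths xs) + 8 * real (end_paths xs) \<le> d \<and> real (end_paths xs) \<le> s"
  proof (cases xs)
    case Nil
    then show ?thesis using nil xs by auto
  next
    case (Cons x ys)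
    define T L where "T = real (all_paths ys)" and "L = real (end_paths ys)"
    have e: "real (end_paths xs) = 1 + real x * L" "real (all_paths xs) = 1 + real x * L + T"
      by (simp_all add: Cons T_def L_def)
    have ys: "set ys \<subseteq> {1, 2, 3}" and sum: "int (sum_list ys) = n - int x" using xs Cons by auto
    consider "x = 1" | "x = 2" | "x = 3" using xs Cons by auto
    then show ?thesis
    proof cases
      case 1
      then have h: "T \<le> a1" "T + L \<le> b1" "T + 4 * L \<le> c1" "T + 8 * L \<le> d1" "L \<le> s1"
        using b1 ys sum n unfolding bounded_at_def T_def L_def by auto
      show ?thesis unfolding e 1
        by (intro conjI) (use h a(1) b(1) c(1) d(1) s(1) in simp_all)
    next
      case 2
      then have h: "T \<le> a2" "T + L \<le> b2" "T + 4 * L \<le> c2" "T + 8 * L \<le> d2" "L \<le> s2"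
        using b2 ys sum n unfolding bounded_at_def T_def L_def by auto
      show ?thesis unfolding e 2
        by (intro conjI) (use h a(2) b(2) c(2) d(2) s(2) in simp_all)
    next
      case 3
      then have h: "T \<le> a3" "T + L \<le> b3" "T + 4 * L \<le> c3" "T + 8 * L \<le> d3" "L \<le> s3"
        using b3 ys sum n unfolding bounded_at_def T_def L_def by auto
      show ?thesis unfolding e 3
        by (intro conjI) (use h a(3) b(3) c(3) d(3) s(3) in simp_all)
    qed
  qed
qed

text \<open>Vacuous, as no list of naturals has a negative sum. This supplies the three rows from
  which the recursion starts.\<close>

lemma bounded_at_neg: "n < 0 \<Longrightarrow> bounded_at n 0 0 0 0 0"
  by (auto simp: bounded_at_def)

text \<open>Each row takes the least numbers that \<open>bounded_at_step\<close> permits; the thirds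
  come from interpolation.\<close>

lemma bounded_at_initial:
  "bounded_at 16 1194 1708 3571 6055 634
   \<and> bounded_at 17 1709 2448 5121 8845 931
   \<and> bounded_at 18 2449 3573 7346 12690 1336"
proof -
  have m: "bounded_at (- 3) 0 0 0 0 0" "bounded_at (- 2) 0 0 0 0 0" "bounded_at (- 1) 0 0 0 0 0"
    by (simp_all add: bounded_at_neg)
  have b0: "bounded_at 0 1 2 5 9 1"
    by (rule bounded_at_step[OF m(1) m(2) m(3)]) simp_all
  have b1: "bounded_at 1 3 5 11 19 2"
    by (rule bounded_at_step[OF m(2) m(3) b0]) simp_all
  have b2: "bounded_at 2 6 9 18 30 3"
    by (rule bounded_at_step[OF m(3) b0 b1]) simp_all
  have b3: "bounded_at 3 10 14 28 48 5"
    by (rule bounded_at_step[OF b0 b1 b2]) simp_all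
  have b4: "bounded_at 4 15 (62/3) 41 69 7"
    by (rule bounded_at_step[OF b1 b2 b3]) simp_all
  have b5: "bounded_at 5 (65/3) 30 63 107 11"
    by (rule bounded_at_step[OF b2 b3 b4]) simp_all
  have b6: "bounded_at 6 31 43 88 152 16"
    by (rule bounded_at_step[OF b3 b4 b5]) simp_all
  have b7: "bounded_at 7 44 65 134 226 23"
    by (rule bounded_at_step[OF b4 b5 b6]) simp_all
  have b8: "bounded_at 8 66 90 189 325 34"
    by (rule bounded_at_step[OF b5 b6 b7]) simp_all
  have b9: "bounded_at 9 91 136 277 465 49"
    by (rule bounded_at_step[OF b6 b7 b8]) simp_all
  have b10: "bounded_at 10 137 191 398 674 70"
    by (rule bounded_at_step[OF b7 b8 b9]) simp_all
  have b11: "bounded_at 11 192 279 568 980 103"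
    by (rule bounded_at_step[OF b8 b9 b10]) simp_all
  have b12: "bounded_at 12 280 400 819 1405 148"
    by (rule bounded_at_step[OF b9 b10 b11]) simp_all
  have b13: "bounded_at 13 401 570 1191 2019 211"
    by (rule bounded_at_step[OF b10 b11 b12]) simp_all
  have b14: "bounded_at 14 571 821 1706 2946 310"
    by (rule bounded_at_step[OF b11 b12 b13]) simp_all
  have b15: "bounded_at 15 822 1193 2446 4226 445"
    by (rule bounded_at_step[OF b12 b13 b14]) simp_all
  have b16: "bounded_at 16 1194 1708 3571 6055 634"
    by (rule bounded_at_step[OF b13 b14 b15]) simp_all
  have b17: "bounded_at 17 1709 2448 5121 8845 931"
    by (rule bounded_at_step[OF b14 b15 b16]) simp_all
  have b18: "bounded_at 18 2449 3573 7346 12690 1336"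
    by (rule bounded_at_step[OF b15 b16 b17]) simp_all
  show ?thesis using b16 b17 b18 by simp
qed

text \<open>The shape is that of a line lengthened by bundles of three arcs: each sends
  \<open>L\<close> to \<open>3 * L + 1\<close> and so triples \<open>2 * L + 1\<close>, and summing
  these \<open>L\<close> yields the term \<open>- 2 * real r\<close>.\<close>

lemma bounded_at_16_plus:
  fixes r :: nat
  defines "q \<equiv> 3 ^ r :: real"
  shows
  "bounded_at (16 + 3 * int r)
     ((4761 * q - 2 * real r + 15) / 4) ((6831 * q - 2 * real r + 1) / 4)
     ((14283 * q - 2 * real r + 1) / 4) ((24219 * q - 2 * real r + 1) / 4) ((1269 * q - 1) / 2)
   \<and> bounded_at (17 + 3 * int r)
     ((6831 * q - 2 * real r + 5) / 4) ((9801 * q - 2 * real r - 9) / 4)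
     ((20493 * q - 2 * real r - 9) / 4) ((35397 * q - 2 * real r - 17) / 4) ((1863 * q - 1) / 2)
   \<and> bounded_at (18 + 3 * int r)
     ((9801 * q - 2 * real r - 5) / 4) ((14283 * q - 2 * real r + 9) / 4)
     ((29403 * q - 2 * real r - 19) / 4) ((50787 * q - 2 * real r - 27) / 4) ((2673 * q - 1) / 2)"
  unfolding q_def
proof (induction r)
  case 0
  show ?case using bounded_at_initial by simp
next
  case (Suc r)
  define q :: real where "q = 3 ^ r"
  have q: "q \<ge> 1" by (simp add: q_def)
  have b: "bounded_at (16 + 3 * int r)
     ((4761 * q - 2 * real r + 15) / 4) ((6831 * q - 2 * real r + 1) / 4)
     ((14283 * q - 2 * real r + 1) / 4) ((24219 * q - 2 * real r + 1) / 4) ((1269 * q - 1) / 2)"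
   "bounded_at (17 + 3 * int r)
     ((6831 * q - 2 * real r + 5) / 4) ((9801 * q - 2 * real r - 9) / 4)
     ((20493 * q - 2 * real r - 9) / 4) ((35397 * q - 2 * real r - 17) / 4) ((1863 * q - 1) / 2)"
   "bounded_at (18 + 3 * int r)
     ((9801 * q - 2 * real r - 5) / 4) ((14283 * q - 2 * real r + 9) / 4)
     ((29403 * q - 2 * real r - 19) / 4) ((50787 * q - 2 * real r - 27) / 4) ((2673 * q - 1) / 2)"
    using Suc.IH by (auto simp: q_def)
  \<comment> \<open>Each new row rests on the three before it, hence this order. The terms in
    \<open>r\<close> cancel, and \<open>q \<ge> 1\<close> settles the inequalities.\<close>
  have b16: "bounded_at (16 + 3 * (int r + 1))
     ((4761 * (3 * q) - 2 * (real r + 1) + 15) / 4) ((6831 * (3 * q) - 2 * (real r + 1) + 1) / 4)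
     ((14283 * (3 * q) - 2 * (real r + 1) + 1) / 4) ((24219 * (3 * q) - 2 * (real r + 1) + 1) / 4)
     ((1269 * (3 * q) - 1) / 2)"
    by (rule bounded_at_step[OF b(1) b(2) b(3)]) (use q in \<open>simp_all add: field_simps\<close>)
  have b17: "bounded_at (17 + 3 * (int r + 1))
     ((6831 * (3 * q) - 2 * (real r + 1) + 5) / 4) ((9801 * (3 * q) - 2 * (real r + 1) - 9) / 4)
     ((20493 * (3 * q) - 2 * (real r + 1) - 9) / 4) ((35397 * (3 * q) - 2 * (real r + 1) - 17) / 4)
     ((1863 * (3 * q) - 1) / 2)"
    by (rule bounded_at_step[OF b(2) b(3) b16]) (use q in \<open>simp_all add: field_simps\<close>)
  have b18: "bounded_at (18 + 3 * (int r + 1))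
     ((9801 * (3 * q) - 2 * (real r + 1) - 5) / 4) ((14283 * (3 * q) - 2 * (real r + 1) + 9) / 4)
     ((29403 * (3 * q) - 2 * (real r + 1) - 19) / 4) ((50787 * (3 * q) - 2 * (real r + 1) - 27) / 4)
     ((2673 * (3 * q) - 1) / 2)"
    by (rule bounded_at_step[OF b(3) b16 b17]) (use q in \<open>simp_all add: field_simps\<close>)
  have "3 ^ Suc r = 3 * q" "real (Suc r) = real r + 1" "int (Suc r) = int r + 1"
    by (simp_all add: q_def)
  then show ?case using b16 b17 b18 by (simp only:)
qed

text \<open>The gain of \<open>d - 1\<close> pays for up to \<open>d\<close> sources feeding the
  first bundle, where the line has only one.\<close>

lemma all_paths_split_last:
  assumes "d \<ge> 2"
  shows "end_paths (ys @ [d]) \<le> end_paths (ys @ [d - 1, 1])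
    \<and> all_paths (ys @ [d]) + (d - 1) \<le> all_paths (ys @ [d - 1, 1])"
proof (induction ys)
  case Nil
  show ?case using assms by simp linarith
next
  case (Cons y ys)
  then have "y * end_paths (ys @ [d]) \<le> y * end_paths (ys @ [d - 1, 1])"
    by (intro mult_left_mono) auto
  then show ?case using Cons by (simp only: append_Cons end_paths.simps all_paths.simps) linarith
qed

section \<open>Walks in acyclic digraphs\<close>

text \<open>An arc is not a loop, so one of its ends differs from \<open>v\<close>; the first step
  of an undirected path from \<open>v\<close> to that end is an arc at \<open>v\<close>.\<close>

lemma connected_acyclic_no_isolated:
  assumes "wf_digraph G" "connected G" "acyclic_digraph G" "arcs G \<noteq> {}" "v \<in> verts G"
  obtains e where "e \<in> arcs G" "tail G e = v \<or> head G e = v"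
proof -
  interpret wf_digraph G by fact
  obtain e where e: "e \<in> arcs G" using assms(4) by blast
  have "tail G e \<noteq> head G e"
  proof
    assume "tail G e = head G e"
    then have "awalk (tail G e) [e] (tail G e)" using e by (simp add: awalk_simps)
    then show False using assms(3) unfolding acyclic_digraph_def by blast
  qed
  then obtain w where w: "w \<in> verts G" "w \<noteq> v" using e by (metis wellformed)
  have "v \<rightarrow>\<^sup>*\<^bsub>with_proj (mk_symmetric G)\<^esub> w"
    using assms(2,5) w(1) by (simp add: connected_def strongly_connected_def)
  then obtain x where "(v, x) \<in> parcs (mk_symmetric G)"
    using w(2) by (cases rule: pre_digraph.converse_reachable_cases) auto
  then show ?thesis using that by (auto simp: parcs_mk_symmetric)
qed

locale fin_acyclic_digraph = fin_digraph +
  assumes acyclic: "acyclic_digraph G"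
begin

definition walks_to :: "'a \<Rightarrow> 'b list set" where
  "walks_to v = {p. \<exists>u. awalk u p v}"

text \<open>A repeated arc would close a cycle. Finiteness of \<open>walks_to\<close> rests on
  this.\<close>

lemma awalk_distinct:
  assumes "awalk u p v"
  shows "distinct p"
proof (rule ccontr)
  assume "\<not> distinct p"
  then obtain xs ys zs y where p: "p = xs @ [y] @ ys @ [y] @ zs"
    using not_distinct_decomp by blast
  have "awalk (tail G y) (y # ys) (tail G y)"
    using assms unfolding p by (auto simp: awalk_simps)
  then show False using acyclic unfolding acyclic_digraph_def by blast
qed

lemma finite_walks_to: "finite (walks_to v)"
proof (rule finite_subset)
  show "walks_to v \<subseteq> {p. set p \<subseteq> arcs G \<and> distinct p}"
    using awalk_distinct by (auto simp: walks_to_def awalk_def)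
  show "finite {p. set p \<subseteq> arcs G \<and> distinct p}"
    by (rule finite_subset_distinct) simp
qed

lemma Nil_in_walks_to: "v \<in> verts G \<Longrightarrow> [] \<in> walks_to v"
  by (auto simp: walks_to_def awalk_Nil_iff)

lemma walks_to_unfold:
  assumes "v \<in> verts G"
  shows "walks_to v = insert [] (\<Union>e\<in>in_arcs G v. (\<lambda>p. p @ [e]) ` walks_to (tail G e))"
    (is "_ = ?R")
proof (intro equalityI subsetI)
  fix p assume "p \<in> walks_to v"
  then obtain u where u: "awalk u p v" by (auto simp: walks_to_def)
  show "p \<in> ?R"
  proof (cases p rule: rev_cases)
    case (snoc q e)
    then have "e \<in> in_arcs G v" "q \<in> walks_to (tail G e)"
      using u by (auto simp: walks_to_def awalk_simps)
    then show ?thesis using snoc by blast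
  qed simp
next
  fix p assume "p \<in> ?R"
  then show "p \<in> walks_to v"
  proof
    assume "p \<in> (\<Union>e\<in>in_arcs G v. (\<lambda>p. p @ [e]) ` walks_to (tail G e))"
    then obtain e q u where "e \<in> arcs G" "head G e = v" "p = q @ [e]" "awalk u q (tail G e)"
      by (auto simp: walks_to_def)
    then have "awalk u p v" using awalk_appendI arc_implies_awalk by metis
    then show ?thesis by (auto simp: walks_to_def)
  qed (use Nil_in_walks_to assms in auto)
qed

lemma card_walks_to:
  assumes "v \<in> verts G"
  shows "card (walks_to v) = 1 + (\<Sum>e\<in>in_arcs G v. card (walks_to (tail G e)))"
proof -
  let ?X = "\<Union>e\<in>in_arcs G v. (\<lambda>p. p @ [e]) ` walks_to (tail G e)"
  have "card ?X = (\<Sum>e\<in>in_arcs G v. card ((\<lambda>p. p @ [e]) ` walks_to (tail G e)))"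
    by (rule card_UN_disjoint) (auto simp: finite_walks_to)
  also have "\<dots> = (\<Sum>e\<in>in_arcs G v. card (walks_to (tail G e)))"
    by (intro sum.cong refl card_image) (auto simp: inj_on_def)
  finally have "card ?X = \<dots>" .
  moreover have "finite ?X" by (auto simp: finite_walks_to)
  moreover have "[] \<notin> ?X" by auto
  ultimately show ?thesis by (simp add: walks_to_unfold[OF assms])
qed

text \<open>The number of walks thus serves as a topological order of the vertices.\<close>

lemma card_walks_to_less:
  assumes "e \<in> arcs G"
  shows "card (walks_to (tail G e)) < card (walks_to (head G e))"
proof -
  have "card (walks_to (tail G e)) \<le> (\<Sum>e\<in>in_arcs G (head G e). card (walks_to (tail G e)))"
    using assms by (intro member_le_sum) auto
  then show ?thesis using assms by (simp add: card_walks_to[of "head G e"])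
qed

text \<open>Paths are sorted by their end. The list \<open>[]\<close> lies in every
  \<open>walks_to v\<close>, so it is removed to make these sets disjoint and counted again as the
  vertex \<open>v\<close>.\<close>

lemma card_FP: "card (FP G) = (\<Sum>v\<in>verts G. card (walks_to v))"
proof -
  let ?X = "{p. p \<noteq> [] \<and> (\<exists>u v. awalk u p v)}"
  have X: "?X = (\<Union>v\<in>verts G. walks_to v - {[]})"
    by (auto simp: walks_to_def)
  have "card ?X = (\<Sum>v\<in>verts G. card (walks_to v - {[]}))"
    unfolding X
  proof (rule card_UN_disjoint)
    have "v = w" if "p \<in> walks_to v" "p \<in> walks_to w" "p \<noteq> []" for p v w
      using that awalk_ends unfolding walks_to_def by blast
    then show "\<forall>v\<in>verts G. \<forall>w\<in>verts G. v \<noteq> w \<longrightarrow> (walks_to v - {[]}) \<inter> (walks_to w - {[]}) = {}"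
      by blast
  qed (auto simp: finite_walks_to)
  moreover have "finite ?X" unfolding X by (auto simp: finite_walks_to)
  moreover have Suc: "card (walks_to v) = 1 + card (walks_to v - {[]})" if "v \<in> verts G" for v
    using that card_Suc_Diff1[OF finite_walks_to Nil_in_walks_to] by simp
  ultimately have "card (FP G) = (\<Sum>v\<in>verts G. 1 + card (walks_to v - {[]}))"
    unfolding FP_def sum.distrib by (simp add: card_Plus)
  also have "\<dots> = (\<Sum>v\<in>verts G. card (walks_to v))"
    by (rule sum.cong) (simp_all add: Suc)
  finally show ?thesis .
qed

section \<open>Comparison of an arbitrary graph with a line\<close>

text \<open>
  A composition is built by adding the non-sources in order of increasing number of walks ending
  there: the in-degree of each becomes the multiplicity of the next bundle of a line. The line
  starts at the least non-source \<open>v0\<close>. Each arc from a source that does not feed \<open>v0\<close> costs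
  at least one walk compared to the line, and \<open>c\<close> records this loss.
\<close>

lemma composition_of_down_closed:
  assumes "finite A" "v0 \<in> A" "A \<subseteq> verts G"
    and src: "\<And>v. v \<in> A \<Longrightarrow> in_arcs G v \<noteq> {}"
    and min: "\<And>v. v \<in> A \<Longrightarrow> card (walks_to v0) \<le> card (walks_to v)"
    and closed: "\<And>e. e \<in> arcs G \<Longrightarrow> head G e \<in> A \<Longrightarrow> tail G e \<in> A \<or> in_arcs G (tail G e) = {}"
    and Z: "Z \<inter> tail G ` in_arcs G v0 = {}" "\<And>v. v \<in> Z \<Longrightarrow> in_arcs G v = {}"
  defines "c \<equiv> \<lambda>v. card {e \<in> in_arcs G v. tail G e \<in> Z}"
  shows "\<exists>ys. (\<forall>y\<in>set ys. 1 \<le> y)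
    \<and> sum_list ys + in_degree G v0 = (\<Sum>v\<in>A. in_degree G v)
    \<and> (\<forall>v\<in>A. card (walks_to v) \<le> end_paths (ys @ [in_degree G v0]))
    \<and> (\<Sum>v\<in>A. card (walks_to v) + c v) + 1 \<le> all_paths (ys @ [in_degree G v0])"
  using assms(1-6)
proof (induction A rule: finite_psubset_induct)
  case (psubset A)
  note fin = psubset.hyps
  have source: "card (walks_to v) = 1" if "v \<in> verts G" "in_arcs G v = {}" for v
    using that by (simp add: card_walks_to)
  \<comment> \<open>A tail that is not a source would lie in \<open>A\<close> and have fewer walks
    than the minimal \<open>v0\<close>.\<close>
  have tail_v0: "card (walks_to (tail G e)) = 1" if "e \<in> in_arcs G v0" for e
  proof -
    have "card (walks_to (tail G e)) < card (walks_to v0)" using that card_walks_to_less by auto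
    then have "in_arcs G (tail G e) = {}" using that psubset.prems by fastforce
    then show ?thesis using that source by auto
  qed
  have v0: "card (walks_to v0) = 1 + in_degree G v0"
    using psubset.prems(1,2) tail_v0 by (subst card_walks_to) (auto simp: in_degree_def)
  have deg: "1 \<le> in_degree G v" if "v \<in> A" for v
    using psubset.prems(3)[OF that] finite_in_arcs[of v] unfolding in_degree_def
    by (metis One_nat_def Suc_leI card_gt_0_iff)
  show ?case
  proof (cases "A = {v0}")
    case True
    \<comment> \<open>\<open>Z\<close> avoids the tails of arcs into \<open>v0\<close>. The
      \<open>+ 1\<close> in the claim is the initial vertex of the line.\<close>
    have "c v0 = 0" using Z(1) unfolding c_def by auto
    then show ?thesis using True v0 by (intro exI[of _ "[]"]) auto
  next
    case False
    then have "A - {v0} \<noteq> {}" using psubset.prems(1) by auto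
    \<comment> \<open>Removing a vertex with the most walks keeps the set closed, as
      \<open>v\<close> is no tail of an arc into \<open>A\<close>. The vertex \<open>v0\<close>
      stays even in case of a tie.\<close>
    then obtain v where v: "v \<in> A - {v0}"
      and Max: "Max ((\<lambda>v. card (walks_to v)) ` (A - {v0})) = card (walks_to v)"
      using obtains_MAX[of "A - {v0}" "\<lambda>v. card (walks_to v)"] fin by blast
    have vmax: "card (walks_to w) \<le> card (walks_to v)" if "w \<in> A" for w
    proof (cases "w = v0")
      case True
      then show ?thesis using v psubset.prems(4) by auto
    next
      case False
      then show ?thesis unfolding Max[symmetric] using that fin by (intro Max_ge) auto
    qed
    define B where "B = A - {v}"
    have B: "finite B" "B \<subset> A" "A = insert v B" "v \<notin> B" "v0 \<in> B"
      using v psubset.prems(1) fin by (auto simp: B_def)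
    have tail_not_v: "tail G e \<noteq> v" if "e \<in> arcs G" "head G e \<in> A" for e
      using that card_walks_to_less[OF that(1)] vmax by force
    have "\<exists>ys. (\<forall>y\<in>set ys. 1 \<le> y)
      \<and> sum_list ys + in_degree G v0 = (\<Sum>v\<in>B. in_degree G v)
      \<and> (\<forall>v\<in>B. card (walks_to v) \<le> end_paths (ys @ [in_degree G v0]))
      \<and> (\<Sum>v\<in>B. card (walks_to v) + c v) + 1 \<le> all_paths (ys @ [in_degree G v0])"
    proof (rule psubset.IH)
      show "tail G e \<in> B \<or> in_arcs G (tail G e) = {}" if "e \<in> arcs G" "head G e \<in> B" for e
        using psubset.prems(5)[OF that(1)] tail_not_v[OF that(1)] that(2) by (auto simp: B_def)
    qed (use B psubset.prems in auto)
    then obtain ys where ys: "\<forall>y\<in>set ys. 1 \<le> y"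
      "sum_list ys + in_degree G v0 = (\<Sum>v\<in>B. in_degree G v)"
      "\<forall>v\<in>B. card (walks_to v) \<le> end_paths (ys @ [in_degree G v0])"
      "(\<Sum>v\<in>B. card (walks_to v) + c v) + 1 \<le> all_paths (ys @ [in_degree G v0])"
      by blast
    define M where "M = end_paths (ys @ [in_degree G v0])"
    have "1 + in_degree G v0 \<le> M" using ys(3) B(5) v0 by (auto simp: M_def)
    then have M: "2 \<le> M" using deg[OF psubset.prems(1)] by simp
    \<comment> \<open>Here the loss is booked: a source ends only one walk, so with
      \<open>M \<ge> 2\<close> an arc from \<open>Z\<close> leaves room for one more.\<close>
    have "card (walks_to (tail G e)) + of_bool (tail G e \<in> Z) \<le> M" if "e \<in> in_arcs G v" for e
    proof (cases "in_arcs G (tail G e) = {}")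
      case True
      then show ?thesis using M source[of "tail G e"] that by auto
    next
      case False
      then have "tail G e \<in> B"
        using that psubset.prems(5)[of e] tail_not_v[of e] v by (auto simp: B_def)
      then show ?thesis using ys(3) False Z(2) by (auto simp: M_def)
    qed
    then have "(\<Sum>e\<in>in_arcs G v. card (walks_to (tail G e)) + of_bool (tail G e \<in> Z))
        \<le> in_degree G v * M"
      unfolding in_degree_def by (rule sum_bounded_above[THEN order_trans]) auto
    moreover have "(\<Sum>e\<in>in_arcs G v. of_bool (tail G e \<in> Z)) = c v"
      unfolding c_def using finite_in_arcs[of v] by (simp add: Int_def)
    moreover have "v \<in> verts G" using v psubset.prems(2) by auto
    ultimately have "card (walks_to v) + c v \<le> 1 + in_degree G v * M"
      using card_walks_to[of v] by (simp add: sum.distrib)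
    moreover have "card (walks_to w) \<le> 1 + in_degree G v * M" if "w \<in> B" for w
    proof -
      have "card (walks_to w) \<le> M" using that ys(3) by (simp add: M_def)
      also have "\<dots> \<le> in_degree G v * M" using deg v by simp
      finally show ?thesis by simp
    qed
    ultimately show ?thesis
      using ys B deg v by (intro exI[of _ "in_degree G v # ys"]) (auto simp: M_def)
  qed
qed

text \<open>Sources not feeding \<open>v0\<close> are paid for by the losses \<open>c\<close>. At
  most \<open>d\<close> sources feed \<open>v0\<close>; if there are several, splitting the first
  bundle of the line makes up for the surplus.\<close>

lemma card_FP_le_all_paths:
  assumes "arcs G \<noteq> {}"
    and no_isolated: "\<And>v. v \<in> verts G \<Longrightarrow> \<exists>e\<in>arcs G. tail G e = v \<or> head G e = v"
  shows "\<exists>xs. (\<forall>x\<in>set xs. 1 \<le> x) \<and> sum_list xs = card (arcs G) \<and> card (FP G) \<le> all_paths xs"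
proof -
  define S W where "S = {v \<in> verts G. in_arcs G v = {}}" and "W = {v \<in> verts G. in_arcs G v \<noteq> {}}"
  have fin: "finite S" "finite W" by (auto simp: S_def W_def)
  have SW: "verts G = S \<union> W" "S \<inter> W = {}" by (auto simp: S_def W_def)
  have head_W: "head G e \<in> W" if "e \<in> arcs G" for e using that by (auto simp: W_def)
  have "W \<noteq> {}" using assms(1) head_W by auto
  then obtain v0 where v0: "v0 \<in> W" "\<And>v. v \<in> W \<Longrightarrow> card (walks_to v0) \<le> card (walks_to v)"
    using arg_min_if_finite(1)[OF fin(2), of "\<lambda>v. card (walks_to v)"]
      arg_min_least[OF fin(2), of _ "\<lambda>v. card (walks_to v)"] by blast
  define S1 where "S1 = S \<inter> tail G ` in_arcs G v0"
  define Z where "Z = S - S1"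
  define c where "c = (\<lambda>v. card {e \<in> in_arcs G v. tail G e \<in> Z})"
  define d where "d = in_degree G v0"
  have "\<exists>ys. (\<forall>y\<in>set ys. 1 \<le> y)
    \<and> sum_list ys + in_degree G v0 = (\<Sum>v\<in>W. in_degree G v)
    \<and> (\<forall>v\<in>W. card (walks_to v) \<le> end_paths (ys @ [in_degree G v0]))
    \<and> (\<Sum>v\<in>W. card (walks_to v) + c v) + 1 \<le> all_paths (ys @ [in_degree G v0])"
    unfolding c_def
    by (rule composition_of_down_closed) (use fin v0 in \<open>auto simp: W_def Z_def S_def S1_def\<close>)
  then obtain ys where ys: "\<forall>y\<in>set ys. 1 \<le> y" "sum_list ys + d = (\<Sum>v\<in>W. in_degree G v)"
    "(\<Sum>v\<in>W. card (walks_to v) + c v) + 1 \<le> all_paths (ys @ [d])"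
    by (auto simp: d_def)
  have "(\<Sum>v\<in>W. in_degree G v) = card (\<Union>v\<in>W. in_arcs G v)"
    unfolding in_degree_def using fin(2) by (subst card_UN_disjoint) auto
  also have "(\<Union>v\<in>W. in_arcs G v) = arcs G" using head_W by auto
  finally have sum: "sum_list ys + d = card (arcs G)" using ys(2) by simp
  \<comment> \<open>A source that is not isolated emits an arc, so each vertex of \<open>Z\<close>
    causes at least one loss.\<close>
  have "Z \<subseteq> tail G ` (\<Union>v\<in>W. {e \<in> in_arcs G v. tail G e \<in> Z})"
  proof
    fix v assume v: "v \<in> Z"
    then have "v \<in> verts G" "in_arcs G v = {}" by (auto simp: Z_def S_def)
    then obtain e where "e \<in> arcs G" "tail G e = v" using no_isolated by fastforce
    then show "v \<in> tail G ` (\<Union>v\<in>W. {e \<in> in_arcs G v. tail G e \<in> Z})" using v head_W by auto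
  qed
  then have "card Z \<le> card (\<Union>v\<in>W. {e \<in> in_arcs G v. tail G e \<in> Z})"
    using fin(2) by (intro surj_card_le) auto
  also have "\<dots> \<le> (\<Sum>v\<in>W. c v)"
    unfolding c_def by (rule card_UN_le) (use fin in auto)
  finally have cZ: "card Z \<le> (\<Sum>v\<in>W. c v)" .
  have "card S = card S1 + card Z"
    unfolding Z_def S1_def using fin(1) by (simp add: card_Diff_subset card_mono)
  moreover have "(\<Sum>v\<in>S. card (walks_to v)) = card S"
    by (simp add: S_def card_walks_to)
  ultimately have "card (FP G) + 1 \<le> card S1 + all_paths (ys @ [d])"
    using cZ ys(3) fin SW by (simp add: card_FP sum.union_disjoint sum.distrib)
  moreover have "card S1 \<le> d"
    unfolding S1_def d_def in_degree_def
    by (rule order_trans[OF card_mono card_image_le]) (auto simp: finite_in_arcs)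
  moreover have "1 \<le> d"
    using v0(1) finite_in_arcs[of v0] unfolding d_def in_degree_def W_def
    by (auto simp: Suc_le_eq card_gt_0_iff)
  ultimately show ?thesis
  proof (cases "card S1 \<le> 1")
    case True
    then show ?thesis using ys(1) sum \<open>1 \<le> d\<close> \<open>card (FP G) + 1 \<le> card S1 + all_paths (ys @ [d])\<close>
      by (intro exI[of _ "ys @ [d]"]) auto
  next
    case False
    then have d: "2 \<le> d" using \<open>card S1 \<le> d\<close> by simp
    then have "card (FP G) \<le> all_paths (ys @ [d - 1, 1])"
      using all_paths_split_last[OF d, of ys] \<open>card S1 \<le> d\<close>
        \<open>card (FP G) + 1 \<le> card S1 + all_paths (ys @ [d])\<close> by linarith
    then show ?thesis using ys(1) sum d by (intro exI[of _ "ys @ [d - 1, 1]"]) auto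
  qed
qed

end

lemma conn_acyclic_digraph_card_FP_le:
  assumes "conn_acyclic_digraph N G" "N > 0"
  shows "\<exists>xs. (\<forall>x\<in>set xs. 1 \<le> x) \<and> sum_list xs = N \<and> card (FP G) \<le> all_paths xs"
proof -
  have G: "wf_digraph G" "connected G" "acyclic_digraph G" "card (arcs G) = N"
    using assms(1) by (auto simp: conn_acyclic_digraph_def)
  \<comment> \<open>An infinite set has \<open>card\<close> 0, so \<open>N > 0\<close> makes the arc
    set finite.\<close>
  have ne: "arcs G \<noteq> {}" "finite (arcs G)" using G(4) assms(2) by (auto intro: card_ge_0_finite)
  note no_isolated = connected_acyclic_no_isolated[OF G(1-3) ne(1)]
  then have "verts G \<subseteq> tail G ` arcs G \<union> head G ` arcs G" by blast
  then have "finite (verts G)" using ne(2) finite_subset by blast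
  then interpret fin_acyclic_digraph G
    using G ne by (intro fin_acyclic_digraph.intro wf_digraph.fin_digraphI fin_acyclic_digraph_axioms.intro)
  show ?thesis using card_FP_le_all_paths ne no_isolated G(4) by metis
qed

section \<open>Lines of bundles of parallel arcs\<close>

text \<open>Coding the \<open>j\<close>-th arc from \<open>i\<close> to \<open>Suc i\<close> as a
  number gives the type used in \<open>P_star\<close>. The list starts at the source, opposite to
  \<open>end_paths\<close>, whence the later \<open>rev\<close>.\<close>

definition line_digraph :: "nat list \<Rightarrow> (nat, nat) pre_digraph" where
  "line_digraph xs = \<lparr> verts = {..length xs},
     arcs = prod_encode ` (SIGMA i:{..<length xs}. {..<xs ! i}),
     tail = (\<lambda>e. fst (prod_decode e)), head = (\<lambda>e. Suc (fst (prod_decode e))) \<rparr>"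

lemma line_digraph_simps [simp]:
  "verts (line_digraph xs) = {..length xs}"
  "arcs (line_digraph xs) = prod_encode ` (SIGMA i:{..<length xs}. {..<xs ! i})"
  "tail (line_digraph xs) e = fst (prod_decode e)"
  "head (line_digraph xs) e = Suc (fst (prod_decode e))"
  by (simp_all add: line_digraph_def)

lemma fin_acyclic_line_digraph: "fin_acyclic_digraph (line_digraph xs)"
proof -
  interpret wf_digraph "line_digraph xs" by unfold_locales auto
  interpret fin_digraph "line_digraph xs" by unfold_locales auto
  \<comment> \<open>Each arc raises the vertex by one, so no nonempty walk is closed.\<close>
  have "cas u p v \<Longrightarrow> v = u + length p" for u p v
    by (induction p arbitrary: u) fastforce+
  then have "acyclic_digraph (line_digraph xs)"
    unfolding acyclic_digraph_def awalk_def by fastforce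
  then show ?thesis by unfold_locales
qed

lemma conn_acyclic_line_digraph:
  assumes "\<forall>x\<in>set xs. 1 \<le> x"
  shows "conn_acyclic_digraph (sum_list xs) (line_digraph xs)"
proof -
  interpret fin_acyclic_digraph "line_digraph xs" by (rule fin_acyclic_line_digraph)
  interpret S: pair_wf_digraph "mk_symmetric (line_digraph xs)" by (rule wellformed_mk_symmetric)
  have adj: "(i, Suc i) \<in> parcs (mk_symmetric (line_digraph xs))" if "i < length xs" for i
  proof -
    have "0 < xs ! i" using assms that nth_mem by fastforce
    then have "prod_encode (i, 0) \<in> arcs (line_digraph xs)" using that by auto
    then show ?thesis unfolding parcs_mk_symmetric by force
  qed
  \<comment> \<open>By symmetry, reaching every vertex from 0 connects any two of them through
    0.\<close>
  have reach: "0 \<rightarrow>\<^sup>*\<^bsub>with_proj (mk_symmetric (line_digraph xs))\<^esub> i" if "i \<le> length xs" for i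
    using that
  proof (induction i)
    case (Suc i)
    then show ?case using adj[of i] S.reachable_adj_trans by auto
  qed auto
  have "connected (line_digraph xs)"
    unfolding connected_def strongly_connected_def
  proof (intro conjI ballI)
    fix u v
    assume "u \<in> verts (with_proj (mk_symmetric (line_digraph xs)))"
      "v \<in> verts (with_proj (mk_symmetric (line_digraph xs)))"
    then show "u \<rightarrow>\<^sup>*\<^bsub>with_proj (mk_symmetric (line_digraph xs))\<^esub> v"
      using reach[of u] reach[of v] S.reachable_trans
        symmetric_reachable[OF symmetric_mk_symmetric]
      by (metis atMost_iff line_digraph_simps(1) pverts_mk_symmetric with_proj_simps(1))
  qed simp
  moreover have "card (arcs (line_digraph xs)) = sum_list xs"
    by (simp add: card_image inj_prod_encode sum_list_sum_nth atLeast0LessThan)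
  ultimately show ?thesis using acyclic wf_digraph_axioms by (simp add: conn_acyclic_digraph_def)
qed

text \<open>The prefix of length \<open>i\<close> is the line up to vertex \<open>i\<close>, so this
  sums the walks over their end vertices.\<close>

lemma sum_end_paths: "(\<Sum>i\<le>length xs. end_paths (rev (take i xs))) = all_paths (rev xs)"
proof (induction xs rule: rev_induct)
  case (snoc x xs)
  have "(\<Sum>i\<le>length xs. end_paths (rev (take i (xs @ [x])))) = (\<Sum>i\<le>length xs. end_paths (rev (take i xs)))"
    by (intro sum.cong) auto
  then show ?case using snoc by simp
qed simp

lemma card_FP_line_digraph: "card (FP (line_digraph xs)) = all_paths (rev xs)"
proof -
  interpret fin_acyclic_digraph "line_digraph xs" by (rule fin_acyclic_line_digraph)
  have "card (walks_to i) = end_paths (rev (take i xs))" if "i \<le> length xs" for i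
    using that
  proof (induction i)
    case 0
    have "in_arcs (line_digraph xs) 0 = {}" by auto
    then show ?case by (simp add: card_walks_to)
  next
    case (Suc i)
    have in_arcs: "in_arcs (line_digraph xs) (Suc i) = (\<lambda>j. prod_encode (i, j)) ` {..<xs ! i}"
      using Suc.prems by (auto simp: in_arcs_def)
    have "card (in_arcs (line_digraph xs) (Suc i)) = xs ! i"
      unfolding in_arcs by (subst card_image) (auto simp: inj_on_def)
    then have "card (walks_to (Suc i)) = 1 + xs ! i * card (walks_to i)"
      using Suc.prems by (subst card_walks_to) (auto simp: in_arcs_def)
    then show ?case using Suc by (simp add: take_Suc_conv_app_nth)
  qed
  then show ?thesis by (simp add: card_FP sum_end_paths[symmetric])
qed

section \<open>The optimal lines and the closed formula\<close>

text \<open>\<open>2 * L + 1\<close> triples with each bundle of three, and summing the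
  \<open>L\<close> is a geometric series.\<close>

lemma paths_replicate_3:
  "2 * real (end_paths (replicate m 3 @ ys)) + 1 = 3 ^ m * (2 * real (end_paths ys) + 1)
   \<and> 4 * real (all_paths (replicate m 3 @ ys))
     = 4 * real (all_paths ys) + 3 * (3 ^ m - 1) * (2 * real (end_paths ys) + 1) - 2 * real m"
  by (induction m) (auto simp: algebra_simps)

lemma best_composition:
  fixes N r :: nat
  assumes "N = 16 + 3 * r \<and> a = (4761 * 3 ^ r - 2 * real r + 15) / 4
    \<or> N = 17 + 3 * r \<and> a = (6831 * 3 ^ r - 2 * real r + 5) / 4
    \<or> N = 18 + 3 * r \<and> a = (9801 * 3 ^ r - 2 * real r - 5) / 4"
  obtains xs where "\<forall>x\<in>set xs. 1 \<le> x" "sum_list xs = N" "real (all_paths xs) = a"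
    "\<And>ys. \<forall>y\<in>set ys. 1 \<le> y \<Longrightarrow> sum_list ys = N \<Longrightarrow> all_paths ys \<le> all_paths xs"
proof -
  obtain b c d s where bounded: "bounded_at (int N) a b c d s"
    using assms bounded_at_16_plus[of r]
    by (elim disjE conjE; simp only: of_nat_add of_nat_mult of_nat_numeral; blast)
  \<comment> \<open>The witnesses attain the bound \<open>a\<close>. The residue of \<open>N\<close>
    modulo 3 decides whether two, one or no extra bundles of 2 stand near the ends.\<close>
  have "\<exists>xs. (\<forall>x\<in>set xs. 1 \<le> x) \<and> sum_list xs = N \<and> real (all_paths xs) = a"
    using assms
  proof (elim disjE conjE)
    assume "N = 16 + 3 * r" "a = (4761 * 3 ^ r - 2 * real r + 15) / 4"
    then show ?thesis
      using paths_replicate_3[of "r + 2" "[2, 2, 1]"]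
      by (intro exI[of _ "[1, 2, 2] @ replicate (r + 2) 3 @ [2, 2, 1]"])
        (auto simp: sum_list_replicate power_add)
  next
    assume "N = 17 + 3 * r" "a = (6831 * 3 ^ r - 2 * real r + 5) / 4"
    then show ?thesis
      using paths_replicate_3[of "r + 3" "[2, 1]"]
      by (intro exI[of _ "[1, 2, 2] @ replicate (r + 3) 3 @ [2, 1]"])
        (auto simp: sum_list_replicate power_add)
  next
    assume "N = 18 + 3 * r" "a = (9801 * 3 ^ r - 2 * real r - 5) / 4"
    then show ?thesis
      using paths_replicate_3[of "r + 4" "[2, 1]"]
      by (intro exI[of _ "[1, 2] @ replicate (r + 4) 3 @ [2, 1]"])
        (auto simp: sum_list_replicate power_add)
  qed
  then obtain xs where xs: "\<forall>x\<in>set xs. 1 \<le> x" "sum_list xs = N" "real (all_paths xs) = a" by blast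
  have "all_paths ys \<le> all_paths xs" if ys: "\<forall>y\<in>set ys. 1 \<le> y" "sum_list ys = N" for ys
  proof -
    obtain zs where "set zs \<subseteq> {1, 2, 3}" "sum_list zs = N" "all_paths ys \<le> all_paths zs"
      using small_entries_suffice[OF ys(1)] ys(2) by auto
    moreover from this have "real (all_paths zs) \<le> a"
      using bounded by (auto simp: bounded_at_def)
    ultimately show ?thesis using xs(3) by linarith
  qed
  with xs show ?thesis using that by blast
qed

theorem theorem3p15:
  fixes N k i :: nat
  assumes "N \<ge> 16" and "N = 3 * k + i" and "i \<in> {0, 1, 2}"
  shows "(\<exists>E :: (nat, nat) pre_digraph. conn_acyclic_digraph N E \<and> card (FP E) = P_star N)
    \<and> (\<forall>E :: ('v, 'e) pre_digraph. conn_acyclic_digraph N E \<longrightarrow> card (FP E) \<le> P_star N)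
    \<and> real (P_star N) =
        (if i = 0 then 1 / 4 * (121 * 3 ^ (k - 2) - 2 * real k + 7)
         else if i = 1 then 1 / 4 * (529 * 3 ^ (k - 3) - 2 * real k + 25)
         else 1 / 4 * (253 * 3 ^ (k - 2) - 2 * real k + 15))"
    (is "_ \<and> _ \<and> _ = ?a")
proof -
  define r where "r = (N - 16) div 3"
  have cases: "N = 16 + 3 * r \<and> ?a = (4761 * 3 ^ r - 2 * real r + 15) / 4
    \<or> N = 17 + 3 * r \<and> ?a = (6831 * 3 ^ r - 2 * real r + 5) / 4
    \<or> N = 18 + 3 * r \<and> ?a = (9801 * 3 ^ r - 2 * real r - 5) / 4"
  proof -
    \<comment> \<open>The leading coefficients match by \<open>4761 = 529 * 9\<close>,
      \<open>6831 = 253 * 27\<close> and \<open>9801 = 121 * 81\<close>.\<close>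
    consider "i = 0" "k = r + 6" | "i = 1" "k = r + 5" | "i = 2" "k = r + 5"
      using assms unfolding r_def by fastforce
    then show ?thesis
      by cases (simp_all add: assms(2) power_add)
  qed
  obtain xs where xs: "\<forall>x\<in>set xs. 1 \<le> x" "sum_list xs = N" "real (all_paths xs) = ?a"
    "\<And>ys. \<forall>y\<in>set ys. 1 \<le> y \<Longrightarrow> sum_list ys = N \<Longrightarrow> all_paths ys \<le> all_paths xs"
    using best_composition[OF cases] by metis
  \<comment> \<open>The bound is polymorphic: it serves both the graphs on \<open>nat\<close> in
    \<open>P_star\<close> and those of arbitrary type.\<close>
  have le: "card (FP E) \<le> all_paths xs" if "conn_acyclic_digraph N E" for E :: "('x, 'y) pre_digraph"
    using conn_acyclic_digraph_card_FP_le[OF that] xs(4) assms(1) by fastforce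
  have line: "conn_acyclic_digraph N (line_digraph (rev xs))"
    "card (FP (line_digraph (rev xs))) = all_paths xs"
    using conn_acyclic_line_digraph[of "rev xs"] card_FP_line_digraph[of "rev xs"] xs(1,2) by simp_all
  have "P_star N = all_paths xs"
    unfolding P_star_def
  proof (rule Max_eqI)
    \<comment> \<open>\<open>Max\<close> is the true maximum only for a finite set; the upper bound
      provides finiteness.\<close>
    show "finite {card (FP E) | E :: (nat, nat) pre_digraph. conn_acyclic_digraph N E}"
      by (rule finite_subset[of _ "{..all_paths xs}"]) (use le in auto)
    show "y \<le> all_paths xs" if "y \<in> {card (FP E) | E :: (nat, nat) pre_digraph. conn_acyclic_digraph N E}" for y
      using that le by auto
    show "all_paths xs \<in> {card (FP E) | E :: (nat, nat) pre_digraph. conn_acyclic_digraph N E}"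
      using line by (metis (mono_tags, lifting) mem_Collect_eq)
  qed
  then show ?thesis using le line xs(3) by metis
qed

end
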